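(* Let $\Pi$ be a discrete probability distribution with support $\{s_i : i\in\mathbb{N}\}$, $0<s_1<s_2<\cdots$, and probabilities $\pi_i=\Pi(\{s_i\})$, $\sum_{i\ge1}\pi_i=1$. Let $\xi\ge 1$ be an integer, let $G_m\sim\mathrm{Erlang}(\xi,\xi)$, let $\gamma>0$, let $\mu_F>0$, and suppose $\rho=\gamma\mu_F<1$. Then for all $u\ge 0$ the probability $\psi_{\Pi\star G_m}(u)$ that the lifetime of a terminating renewal process with defective renewal distribution $\rho\,(\Pi\star G_m)$ exceeds $u$ is given by $$\psi_{\Pi\star G_m}(u)=\sum_{n=0}^{\infty}\kappa_n\frac{(\xi u/s_1)^n e^{-\xi u/s_1}}{n!},$$ where $$\kappa_n=\begin{cases}\gamma\mu_F, & 0\le n\le \xi-1,\\[4pt] \gamma\mu_F\left[\displaystyle\sum_{i=\xi-1}^{n-1}\kappa_{n-1-i}\,\mathcal{B}_i+\mathcal{C}_n\right], & n\ge \xi,\end{cases}$$ and $$\mathcal{B}_i=\sum_{j=1}^{\infty}\frac{\pi_j s_1}{s_j}\,\mathrm{bin}(\xi-1;i,s_1/s_j),\qquad \mathcal{C}_n=\sum_{j=1}^{\infty}\pi_j\,\mathrm{Bin}(\xi-1;n,s_1/s_j).$$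
   Context: $\mathrm{Erlang}(\xi,\xi)$ is the Gamma distribution with shape $\xi$ and rate $\xi$ (mean $1$). The Mellin--Stieltjes convolution of nonnegative distributions is $\Pi\star G(u)=\int_0^\infty G(u/s)\,d\Pi(s)$, the distribution of the product of two independent random variables with laws $\Pi$ and $G$. For a probability distribution $H$ on $[0,\infty)$ and $\rho\in(0,1)$, $\psi_H(u):=(1-\rho)\sum_{n=1}^\infty\rho^n\,(1-H^{*n}(u))$, where $H^{*n}$ is the $n$-fold additive convolution; this is the probability that a terminating renewal process with defective inter-renewal distribution $\rho H$ (i.e. each renewal occurs with probability $\rho$, independently, with increment distributed as $H$) has lifetime exceeding $u$. $\mathrm{bin}(\cdot;n,p)$ and $\mathrm{Bin}(\cdot;n,p)$ are the probability mass function and the cumulative distribution function of the binomial distribution with parameters $n$ and $p$. Here $\gamma$ is the Poisson claim intensity and $\mu_F$ the (finite) mean claim size of a Cramér--Lundberg model. Convention $0^0=1$. *)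

theory Defs
  imports "HOL-Probability.Probability"
begin

text \<open>
  The library function \<^const>\<open>erlang_density\<close> takes the shape minus one as its first argument.
\<close>
definition erlang :: "nat \<Rightarrow> real \<Rightarrow> real measure" where
  "erlang k r = density lborel (erlang_density (k - 1) r)"

text \<open>
  The law of the product of two independent random variables with laws \<open>P\<close> and \<open>G\<close>.
  The lemma \<open>cdf_mellin_conv\<close> below recovers the integral formula for its distribution function.
\<close>
definition mellin_conv :: "real measure \<Rightarrow> real measure \<Rightarrow> real measure" where
  "mellin_conv P G = distr (P \<Otimes>\<^sub>M G) borel (\<lambda>(s, x). s * x)"

lemma cdf_mellin_conv:
  fixes P :: "real pmf"
  assumes "real_distribution G" and pos: "\<And>s. s \<in> set_pmf P \<Longrightarrow> 0 < s"
  shows "cdf (mellin_conv (measure_pmf P) G) u = (\<integral>s. cdf G (u / s) \<partial>measure_pmf P)"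
proof -
  interpret G: real_distribution G by fact
  interpret PG: pair_prob_space "measure_pmf P" G ..
  have "(\<lambda>x. fst x * snd x) \<in> borel_measurable (measure_pmf P \<Otimes>\<^sub>M G)"
    by (intro borel_measurable_times measurable_compose[OF measurable_fst]
          measurable_compose[OF measurable_snd]) auto
  then have m: "(\<lambda>(s, x). s * x) \<in> borel_measurable (measure_pmf P \<Otimes>\<^sub>M G)"
    by (simp add: case_prod_beta)
  let ?A = "(\<lambda>(s, x). s * x) -` {..u} \<inter> space (measure_pmf P \<Otimes>\<^sub>M G)"
  have A: "?A \<in> sets (measure_pmf P \<Otimes>\<^sub>M G)"
    using m by (rule measurable_sets) simp
  have "cdf (mellin_conv (measure_pmf P) G) u = measure (measure_pmf P \<Otimes>\<^sub>M G) ?A"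
    unfolding cdf_def mellin_conv_def by (rule measure_distr[OF m]) simp
  also have "\<dots> = (\<integral>s. measure G (Pair s -` ?A) \<partial>measure_pmf P)"
  proof -
    have "emeasure (measure_pmf P \<Otimes>\<^sub>M G) ?A = (\<integral>\<^sup>+s. emeasure G (Pair s -` ?A) \<partial>measure_pmf P)"
      by (rule G.emeasure_pair_measure_alt[OF A])
    also have "\<dots> = (\<integral>\<^sup>+s. ennreal (measure G (Pair s -` ?A)) \<partial>measure_pmf P)"
      by (simp add: G.emeasure_eq_measure)
    also have "\<dots> = ennreal (\<integral>s. measure G (Pair s -` ?A) \<partial>measure_pmf P)"
      by (intro nn_integral_eq_integral measure_pmf.integrable_const_bound[where B = 1]) auto
    finally show ?thesis
      by (simp add: measure_def)
  qed
  also have "\<dots> = (\<integral>s. cdf G (u / s) \<partial>measure_pmf P)"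
  proof (rule integral_cong_AE)
    show "AE s in measure_pmf P. measure G (Pair s -` ?A) = cdf G (u / s)"
    proof (rule AE_pmfI)
      fix s assume "s \<in> set_pmf P"
      then have "Pair s -` ?A = {..u / s}"
        using pos by (auto simp: space_pair_measure field_simps)
      then show "measure G (Pair s -` ?A) = cdf G (u / s)" by (simp add: cdf_def)
    qed
  qed auto
  finally show ?thesis .
qed

primrec conv_power :: "real measure \<Rightarrow> nat \<Rightarrow> real measure" where
  "conv_power H 0 = return borel 0"
| "conv_power H (Suc n) = convolution (conv_power H n) H"

text \<open>
  \<open>psi \<rho> H u\<close> is the probability that the lifetime of a terminating renewal process with
  defective inter-renewal distribution \<open>\<rho> H\<close> exceeds \<open>u\<close>.
\<close>
definition psi :: "real \<Rightarrow> real measure \<Rightarrow> real \<Rightarrow> real" where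
  "psi \<rho> H u = (1 - \<rho>) * (\<Sum>n. \<rho> ^ Suc n * (1 - cdf (conv_power H (Suc n)) u))"

text \<open>
  Sequences over the positive integers (such as \<open>s\<close> and \<open>j \<mapsto> \<pi>\<^sub>j\<close>) are functions on \<^typ>\<open>nat\<close>
  whose value at \<open>0\<close> is never used, whence the arguments \<open>Suc j\<close> in the series below.
  In \<open>bin(k; n, p)\<close> and \<open>Bin(k; n, p)\<close>, \<open>n\<close> is the number of trials.
\<close>
definition coeff_B :: "real pmf \<Rightarrow> (nat \<Rightarrow> real) \<Rightarrow> nat \<Rightarrow> nat \<Rightarrow> real" where
  "coeff_B P s \<xi> i =
     (\<Sum>j. pmf P (s (Suc j)) * s 1 / s (Suc j) * pmf (binomial_pmf i (s 1 / s (Suc j))) (\<xi> - 1))"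

definition coeff_C :: "real pmf \<Rightarrow> (nat \<Rightarrow> real) \<Rightarrow> nat \<Rightarrow> nat \<Rightarrow> real" where
  "coeff_C P s \<xi> n =
     (\<Sum>j. pmf P (s (Suc j)) *
        measure (measure_pmf (binomial_pmf n (s 1 / s (Suc j)))) {..\<xi> - 1})"

text \<open>The summation range is \<open>\<xi> - 1 \<le> i \<le> n - 1\<close>.\<close>
function kappa :: "real \<Rightarrow> real \<Rightarrow> real pmf \<Rightarrow> (nat \<Rightarrow> real) \<Rightarrow> nat \<Rightarrow> nat \<Rightarrow> real" where
  "kappa \<gamma> \<mu> P s \<xi> n =
     (if n < \<xi> then \<gamma> * \<mu>
      else \<gamma> * \<mu> * ((\<Sum>i\<in>{\<xi> - 1..<n}. kappa \<gamma> \<mu> P s \<xi> (n - 1 - i) * coeff_B P s \<xi> i)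
                    + coeff_C P s \<xi> n))"
  by pat_completeness auto
termination
  by (relation "Wellfounded.measure (\<lambda>(\<gamma>, \<mu>, P, s, \<xi>, n). n)") auto

declare kappa.simps [simp del]

end

theory Submission
  imports Defs
begin

text \<open>
  Uniformization: run a Poisson process at the largest rate \<open>l = \<xi> / s\<^sub>1\<close>. Thinning it with
  probability \<open>s\<^sub>1 / s\<^sub>j\<close> gives a process of rate \<open>\<xi> / s\<^sub>j\<close>, so the \<open>Erlang(\<xi>, \<xi> / s\<^sub>j)\<close>
  component of the mixture is the time of the \<open>l\<close>-event at which the \<open>\<xi>\<close>-th success occurs. Hence
  \<open>\<Pi> \<star> G\<close> has density \<open>\<Sum>\<^sub>n B\<^sub>n e\<^sub>n\<close> and tail \<open>\<Sum>\<^sub>n C\<^sub>n q\<^sub>n\<close>, where \<open>e\<^sub>n\<close> is the density of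
  the \<open>(n+1)\<close>-st event and \<open>q\<^sub>n = e\<^sub>n / l\<close> the Poisson weight, and the closure of Erlang densities
  under convolution turns the recursion for \<open>\<kappa>\<close> into the renewal equation
  \<open>f u = \<rho> H(u, \<infinity>) + \<rho> \<integral>\<^sub>[\<^sub>0\<^sub>,\<^sub>u\<^sub>] f (u - y) dH(y)\<close> for the claimed series. The function \<open>\<psi>\<close>
  satisfies the same equation, whose bounded solutions are unique because \<open>\<rho> < 1\<close>.
\<close>

section \<open>Binomial thinning of Poisson weights and Erlang densities\<close>

text \<open>The terms with \<open>n < k\<close> vanish. After the shift by \<open>k\<close> the
  binomial coefficient cancels against the factorial, leaving the exponential series of
  \<open>(1 - p) * x\<close>, and
  \<open>exp (- x) * exp ((1 - p) * x) = exp (- (p * x))\<close>.\<close>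

lemma poisson_thinning:
  fixes x p :: real
  assumes p: "p \<in> {0..1}"
  shows "(\<lambda>n. pmf (binomial_pmf n p) k * (x ^ n * exp (- x) / fact n)) sums ((p * x) ^ k * exp (- (p * x)) / fact k)"
proof -
  let ?f = "\<lambda>n. pmf (binomial_pmf n p) k * (x ^ n * exp (- x) / fact n)"
  have pmf_eq: "pmf (binomial_pmf n p) k = real (n choose k) * p ^ k * (1 - p) ^ (n - k)" for n
    using p by simp
  have zero: "?f n = 0" if "n < k" for n
    using that by (simp add: pmf_eq del: pmf_binomial)
  have shift: "?f (n + k) = (p * x) ^ k * exp (- x) / fact k * (((1 - p) * x) ^ n /\<^sub>R fact n)" for n
  proof -
    have "real (n + k choose k) * p ^ k * q ^ n * (x ^ (n + k) * exp (- x) / fact (n + k)) =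
        (p * x) ^ k * exp (- x) / fact k * ((q * x) ^ n /\<^sub>R fact n)" for q
      by (simp add: binomial_fact power_add power_mult_distrib field_simps)
    then show ?thesis unfolding pmf_eq by simp
  qed
  have "(\<lambda>n. (p * x) ^ k * exp (- x) / fact k * (((1 - p) * x) ^ n /\<^sub>R fact n)) sums
      ((p * x) ^ k * exp (- x) / fact k * exp ((1 - p) * x))"
    by (intro sums_mult exp_converges)
  moreover have "exp (- x) * exp ((1 - p) * x) = exp (- (p * x))"
    by (simp add: exp_add[symmetric] algebra_simps)
  hence "(p * x) ^ k * exp (- x) / fact k * exp ((1 - p) * x) = (p * x) ^ k * exp (- (p * x)) / fact k"
    by (metis (no_types, opaque_lifting) times_divide_eq_left mult.assoc)
  ultimately have "(\<lambda>n. ?f (n + k)) sums ((p * x) ^ k * exp (- (p * x)) / fact k)"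
    by (simp only: shift)
  with zero show ?thesis
    using sums_zero_iff_shift[of k ?f] by blast
qed

lemma prob_binomial_pmf_atMost:
  "measure (measure_pmf (binomial_pmf n p)) {..k} = (\<Sum>i\<le>k. pmf (binomial_pmf n p) i)"
  by (rule measure_measure_pmf_finite) simp

lemma pmf_binomial_pmf_Suc_Suc:
  assumes "p \<in> {0..1}"
  shows "pmf (binomial_pmf (Suc n) p) (Suc k) =
    p * pmf (binomial_pmf n p) k + (1 - p) * pmf (binomial_pmf n p) (Suc k)"
proof (cases "k < n")
  case True
  \<comment> \<open>Truncated subtraction forces the case split: for \<open>k < n\<close> one factor
    \<open>1 - p\<close> is split off, otherwise \<open>n choose Suc k\<close> is zero.\<close>
  then have "n - k = Suc (n - Suc k)" by simp
  then show ?thesis using assms by (simp add: algebra_simps)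
next
  case False
  then show ?thesis using assms by (simp add: algebra_simps)
qed

text \<open>At most \<open>k\<close> successes in \<open>n\<close> trials means either still at most
  \<open>k\<close> after one more trial, or exactly \<open>k\<close> followed by a success. The
  induction on \<open>k\<close> derives this from the Pascal rule above.\<close>

lemma prob_binomial_pmf_atMost_Suc:
  assumes p: "p \<in> {0..1}"
  shows "p * pmf (binomial_pmf n p) k + measure (measure_pmf (binomial_pmf (Suc n) p)) {..k} =
    measure (measure_pmf (binomial_pmf n p)) {..k}"
proof (induction k)
  case 0
  then show ?case using p by (simp add: prob_binomial_pmf_atMost algebra_simps del: atMost_0)
next
  case (Suc k)
  have "(\<Sum>i\<le>k. pmf (binomial_pmf (Suc n) p) i) = (\<Sum>i\<le>k. pmf (binomial_pmf n p) i) - p * pmf (binomial_pmf n p) k"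
    using Suc by (simp add: prob_binomial_pmf_atMost del: pmf_binomial)
  then show ?case
    using pmf_binomial_pmf_Suc_Suc[OF p, of n k]
    unfolding prob_binomial_pmf_atMost sum.atMost_Suc
    by (simp add: algebra_simps del: pmf_binomial)
qed

text \<open>The preceding identity telescopes: the summand is the probability that success number
  \<open>k + 1\<close> occurs at trial \<open>i + 1\<close>, the last term that it has not occurred
  by trial \<open>n\<close>.\<close>

lemma sum_pmf_binomial_pmf_add_prob_atMost:
  assumes "p \<in> {0..1}"
  shows "(\<Sum>i<n. p * pmf (binomial_pmf i p) k) + measure (measure_pmf (binomial_pmf n p)) {..k} = 1"
proof (induction n)
  case 0
  then show ?case using assms by (simp add: binomial_pmf_0)
next
  case (Suc n)
  then show ?case
    using prob_binomial_pmf_atMost_Suc[OF assms, of n k] by (simp del: pmf_binomial)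
qed

lemma prob_binomial_pmf_atMost_eq_1:
  assumes "p \<in> {0..1}" "n \<le> k"
  shows "measure (measure_pmf (binomial_pmf n p)) {..k} = 1"
  using assms by (subst measure_pmf.prob_eq_1) (auto simp: AE_measure_pmf_iff set_pmf_binomial_eq split: if_splits)

text \<open>An Erlang density on the half-line is its rate times a Poisson weight, so this is
  \<open>poisson_thinning\<close> at \<open>l * y\<close>, multiplied by
  \<open>p * l\<close>.\<close>

lemma erlang_density_sums:
  assumes p: "p \<in> {0..1}"
  shows "(\<lambda>n. p * pmf (binomial_pmf n p) k * erlang_density n l y) sums erlang_density k (p * l) y"
proof (cases "y < 0")
  case True
  then show ?thesis by (simp add: erlang_density_def)
next
  case False
  then have eq: "erlang_density n r y = r * ((r * y) ^ n * exp (- (r * y)) / fact n)" for n r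
    by (simp add: erlang_density_def power_mult_distrib)
  have "(\<lambda>n. p * l * (pmf (binomial_pmf n p) k * ((l * y) ^ n * exp (- (l * y)) / fact n))) sums
      (p * l * ((p * (l * y)) ^ k * exp (- (p * (l * y))) / fact k))"
    by (intro sums_mult poisson_thinning p)
  then show ?thesis
    by (simp add: eq mult_ac del: pmf_binomial)
qed

text \<open>The Erlang tail is the Poisson probability of at most \<open>k\<close> events, so
  thinning is summed over these \<open>k + 1\<close> values.\<close>

lemma erlang_tail_sums:
  assumes p: "p \<in> {0..1}" and u: "0 \<le> u"
  shows "(\<lambda>n. measure (measure_pmf (binomial_pmf n p)) {..k} * ((l * u) ^ n * exp (- (l * u)) / fact n))
    sums (1 - erlang_CDF k (p * l) u)"
proof -
  have "(\<lambda>n. \<Sum>i\<le>k. pmf (binomial_pmf n p) i * ((l * u) ^ n * exp (- (l * u)) / fact n))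
    sums (\<Sum>i\<le>k. (p * (l * u)) ^ i * exp (- (p * (l * u))) / fact i)"
    by (intro sums_sum poisson_thinning p)
  moreover have "(\<Sum>i\<le>k. (p * (l * u)) ^ i * exp (- (p * (l * u))) / fact i) = 1 - erlang_CDF k (p * l) u"
    using u by (simp add: erlang_CDF_def mult.assoc)
  ultimately show ?thesis
    by (simp only: prob_binomial_pmf_atMost sum_distrib_right)
qed

section \<open>Comparison of solutions of a renewal equation\<close>

text \<open>Induction on \<open>n\<close> gives \<open>f u \<le> g u + r ^ n\<close>: the bound on
  \<open>f\<close> starts it, and since \<open>H\<close> has mass one each use of the equation
  multiplies the error by \<open>r\<close>. Then let \<open>n\<close> tend to infinity. Used in both
  directions, the inequality yields uniqueness among solutions bounded by one; working in
  \<open>ennreal\<close> avoids integrability conditions.\<close>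

lemma renewal_equation_le:
  fixes f g a :: "real \<Rightarrow> ennreal" and r :: ennreal
  assumes H: "prob_space H" and sets [measurable_cong]: "sets H = sets borel"
    and [measurable]: "g \<in> borel_measurable borel"
    and f: "\<And>u. 0 \<le> u \<Longrightarrow> f u = a u + r * (\<integral>\<^sup>+y. f (u - y) * indicator {0..u} y \<partial>H)"
    and g: "\<And>u. 0 \<le> u \<Longrightarrow> g u = a u + r * (\<integral>\<^sup>+y. g (u - y) * indicator {0..u} y \<partial>H)"
    and f_le: "\<And>u. 0 \<le> u \<Longrightarrow> f u \<le> 1" and r: "r < 1" and u: "0 \<le> u"
  shows "f u \<le> g u"
proof -
  interpret H: prob_space H by fact
  have step: "f u \<le> g u + r ^ n" if "0 \<le> u" for n u
    using that
  proof (induction n arbitrary: u)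
    case 0
    have "f u \<le> 0 + 1" using f_le[OF 0] by simp
    also have "\<dots> \<le> g u + 1" by (intro add_mono) auto
    finally show ?case by simp
  next
    case (Suc n)
    have "(\<integral>\<^sup>+y. f (u - y) * indicator {0..u} y \<partial>H)
        \<le> (\<integral>\<^sup>+y. g (u - y) * indicator {0..u} y + r ^ n \<partial>H)"
      using Suc.IH by (intro nn_integral_mono) (auto split: split_indicator)
    also have "\<dots> = (\<integral>\<^sup>+y. g (u - y) * indicator {0..u} y \<partial>H) + r ^ n"
      by (subst nn_integral_add) (auto simp: H.emeasure_space_1)
    finally have "f u \<le> a u + r * ((\<integral>\<^sup>+y. g (u - y) * indicator {0..u} y \<partial>H) + r ^ n)"
      unfolding f[OF Suc.prems] by (intro add_mono mult_left_mono) auto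
    also have "\<dots> = g u + r ^ Suc n"
      unfolding g[OF Suc.prems] by (simp add: distrib_left add.assoc)
    finally show ?case .
  qed
  obtain q where q: "r = ennreal q" "0 \<le> q" "q < 1"
    using r by (cases r) (auto simp: ennreal_less_one_iff)
  have "(\<lambda>n. q ^ n) \<longlonglongrightarrow> 0" using q by (intro LIMSEQ_realpow_zero) auto
  then have "(\<lambda>n. ennreal (q ^ n)) \<longlonglongrightarrow> ennreal 0" by (rule tendsto_ennrealI)
  then have "(\<lambda>n. r ^ n) \<longlonglongrightarrow> 0" using q by (simp add: ennreal_power)
  then have "(\<lambda>n. g u + r ^ n) \<longlonglongrightarrow> g u + 0" by (intro tendsto_add tendsto_const)
  then have "f u \<le> g u + 0"
    by (rule tendsto_lowerbound) (use step[OF u] in auto)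
  then show ?thesis by simp
qed

section \<open>The renewal equation for \<open>psi\<close>\<close>

locale nonneg_real_distribution = real_distribution M for M :: "real measure" +
  assumes AE_nonneg: "AE x in M. 0 \<le> x"

lemma nonneg_real_distribution_convolution:
  assumes "nonneg_real_distribution M" "nonneg_real_distribution N"
  shows "nonneg_real_distribution (M \<star> N)"
proof -
  interpret M: nonneg_real_distribution M by fact
  interpret N: nonneg_real_distribution N by fact
  have fin: "finite_measure M" "finite_measure N"
    by unfold_locales
  have "emeasure (M \<star> N) UNIV = (\<integral>\<^sup>+x. \<integral>\<^sup>+y. indicator UNIV (x + y) \<partial>N \<partial>M)"
    using fin by (intro convolution_emeasure') auto
  also have "\<dots> = 1"
    using M.emeasure_space_1 N.emeasure_space_1 by simp
  finally have 1: "emeasure (M \<star> N) (space (M \<star> N)) = 1"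
    by simp
  have "emeasure (M \<star> N) {..<0} = (\<integral>\<^sup>+x. \<integral>\<^sup>+y. indicator {..<0} (x + y) \<partial>N \<partial>M)"
    using fin by (intro convolution_emeasure') auto
  also have "\<dots> = (\<integral>\<^sup>+x. 0 \<partial>M)"
  proof (intro nn_integral_cong_AE, use M.AE_nonneg in eventually_elim)
    fix x :: real assume x: "0 \<le> x"
    have "(\<integral>\<^sup>+y. indicator {..<0} (x + y) \<partial>N) = (\<integral>\<^sup>+y. 0 \<partial>N)"
      by (intro nn_integral_cong_AE, use N.AE_nonneg in eventually_elim) (use x in auto)
    then show "(\<integral>\<^sup>+y. indicator {..<0} (x + y) \<partial>N) = 0" by simp
  qed
  finally have "emeasure (M \<star> N) {..<0} = 0" by simp
  then have "AE x in M \<star> N. x \<notin> {..<0}"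
    by (intro AE_not_in) (simp add: null_sets_def)
  then have "AE x in M \<star> N. 0 \<le> x" by eventually_elim auto
  moreover have "prob_space (M \<star> N)"
    using 1 by (rule prob_spaceI)
  ultimately show ?thesis
    by (simp add: nonneg_real_distribution_def nonneg_real_distribution_axioms_def
        real_distribution_def real_distribution_axioms_def)
qed

context nonneg_real_distribution
begin

lemma nonneg_conv_power: "nonneg_real_distribution (conv_power M n)"
proof (induction n)
  case 0
  have "AE x in return borel 0. 0 \<le> (x::real)"
    by (subst AE_return) auto
  then show ?case
    by (simp add: nonneg_real_distribution_def nonneg_real_distribution_axioms_def
        real_distribution_def real_distribution_axioms_def prob_space_return)
next
  case (Suc n)
  then show ?case
    by (simp add: nonneg_real_distribution_convolution nonneg_real_distribution_axioms)
qed

lemma emeasure_greaterThan: "emeasure M {v<..} = ennreal (1 - cdf M v)"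
proof -
  have "{v<..} = space M - {..v}" by auto
  then show ?thesis
    using prob_compl[of "{..v}"] by (simp add: emeasure_eq_measure cdf_def)
qed

lemma emeasure_greaterThan_neg:
  assumes "v < 0"
  shows "emeasure M {v<..} = 1"
  using AE_nonneg assms by (intro emeasure_eq_1_AE) auto

lemma measurable_emeasure_greaterThan [measurable]:
  "(\<lambda>v. emeasure M {v<..}) \<in> borel_measurable borel"
proof -
  have "cdf M \<in> borel_measurable borel"
    by (intro borel_measurable_mono) (auto simp: mono_def cdf_nondecreasing)
  then show ?thesis unfolding emeasure_greaterThan by simp
qed

text \<open>Condition on one increment \<open>y\<close>. If \<open>y > u\<close>, the level is
  already exceeded, since the other increments are almost surely nonnegative; otherwise they must
  exceed \<open>u - y\<close>. Commutativity brings the increment that \<open>conv_power\<close>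
  adds last to the front.\<close>

lemma conv_power_Suc_tail:
  assumes u: "0 \<le> u"
  shows "emeasure (conv_power M (Suc n)) {u<..} =
    emeasure M {u<..} + (\<integral>\<^sup>+y. emeasure (conv_power M n) {u - y<..} * indicator {0..u} y \<partial>M)"
proof -
  interpret C: nonneg_real_distribution "conv_power M n" by (rule nonneg_conv_power)
  have fin: "finite_measure M" "finite_measure (conv_power M n)" by unfold_locales
  have "emeasure (conv_power M (Suc n)) {u<..} = emeasure (M \<star> conv_power M n) {u<..}"
    using fin by (simp add: convolution_commutative)
  also have "\<dots> = (\<integral>\<^sup>+y. emeasure (conv_power M n) {a. a + y \<in> {u<..}} \<partial>M)"
    using fin by (intro convolution_emeasure) auto
  also have "\<dots> = (\<integral>\<^sup>+y. emeasure (conv_power M n) {u - y<..} \<partial>M)"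
    by (intro nn_integral_cong arg_cong2[where f = emeasure]) auto
  also have "\<dots> = (\<integral>\<^sup>+y. indicator {u<..} y + emeasure (conv_power M n) {u - y<..} * indicator {0..u} y \<partial>M)"
    by (intro nn_integral_cong_AE, use AE_nonneg in eventually_elim)
      (auto simp: C.emeasure_greaterThan_neg split: split_indicator)
  also have "\<dots> = emeasure M {u<..} + (\<integral>\<^sup>+y. emeasure (conv_power M n) {u - y<..} * indicator {0..u} y \<partial>M)"
    by (subst nn_integral_add) auto
  finally show ?thesis .
qed

text \<open>The series in \<open>psi\<close> is dominated by a geometric series of sum
  \<open>r / (1 - r)\<close>, so it converges and \<open>psi\<close> is at most \<open>r\<close>.
  The form in \<open>ennreal\<close> allows sums and integrals to be exchanged freely.\<close>

lemma
  assumes r: "0 < r" "r < 1"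
  shows ennreal_psi: "ennreal (psi r M u) =
      (\<Sum>n. ennreal ((1 - r) * r ^ Suc n) * emeasure (conv_power M (Suc n)) {u<..})" (is ?A)
    and psi_nonneg: "0 \<le> psi r M u" (is ?B)
    and psi_le_1: "psi r M u \<le> 1" (is ?C)
proof -
  let ?t = "\<lambda>n. r ^ Suc n * (1 - cdf (conv_power M (Suc n)) u)"
  have cdf: "0 \<le> 1 - cdf (conv_power M n) u" "1 - cdf (conv_power M n) u \<le> 1"
    "emeasure (conv_power M n) {u<..} = ennreal (1 - cdf (conv_power M n) u)" for n
  proof -
    interpret C: nonneg_real_distribution "conv_power M n" by (rule nonneg_conv_power)
    show "0 \<le> 1 - cdf (conv_power M n) u" "1 - cdf (conv_power M n) u \<le> 1"
      "emeasure (conv_power M n) {u<..} = ennreal (1 - cdf (conv_power M n) u)"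
      using C.cdf_bounded_prob C.cdf_nonneg by (auto simp: C.emeasure_greaterThan)
  qed
  have t: "0 \<le> ?t n" "?t n \<le> r * r ^ n" for n
    using r cdf[of "Suc n"] by (auto intro!: mult_nonneg_nonneg mult_left_le simp del: conv_power.simps)
  have geo: "(\<lambda>n. r * r ^ n) sums (r * (1 / (1 - r)))"
    using r by (intro sums_mult geometric_sums) auto
  have sm: "summable ?t"
    by (rule summable_comparison_test'[OF sums_summable[OF geo]]) (use t in auto)
  have "suminf ?t \<le> r * (1 / (1 - r))"
    using suminf_le[OF _ sm sums_summable[OF geo]] t(2) sums_unique[OF geo] by simp
  then have "(1 - r) * suminf ?t \<le> (1 - r) * (r * (1 / (1 - r)))"
    using r by (intro mult_left_mono) auto
  with r show ?C by (simp add: psi_def)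
  show ?B
    unfolding psi_def using r by (intro mult_nonneg_nonneg suminf_nonneg[OF sm t(1)]) auto
  have "ennreal (psi r M u) = ennreal (\<Sum>n. (1 - r) * ?t n)"
    unfolding psi_def by (subst suminf_mult[OF sm]) simp
  also have "\<dots> = (\<Sum>n. ennreal ((1 - r) * ?t n))"
    using r by (intro suminf_ennreal2[symmetric] mult_nonneg_nonneg[OF _ t(1)] summable_mult sm) auto
  also have "\<dots> = (\<Sum>n. ennreal ((1 - r) * r ^ Suc n) * emeasure (conv_power M (Suc n)) {u<..})"
    unfolding cdf(3) using r cdf(1)
    by (subst ennreal_mult[symmetric]) (auto simp only: mult.assoc intro!: mult_nonneg_nonneg zero_le_power)
  finally show ?A .
qed

lemma measurable_ennreal_psi [measurable]:
  assumes r: "0 < r" "r < 1"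
  shows "(\<lambda>u. ennreal (psi r M u)) \<in> borel_measurable borel"
proof -
  have [measurable]: "(\<lambda>v. emeasure (conv_power M n) {v<..}) \<in> borel_measurable borel" for n
    by (rule nonneg_real_distribution.measurable_emeasure_greaterThan[OF nonneg_conv_power])
  show ?thesis unfolding ennreal_psi[OF r] by measurable
qed

text \<open>Each tail in the series is split by \<open>conv_power_Suc_tail\<close>. The weights
  \<open>c n\<close> have sum \<open>r\<close>, which gives the first term; they satisfy
  \<open>c (Suc n) = r * c n\<close>, which rebuilds \<open>psi\<close> under the integral.\<close>

lemma psi_renewal:
  assumes r: "0 < r" "r < 1" and u: "0 \<le> u"
  shows "ennreal (psi r M u) = ennreal r * emeasure M {u<..} +
    ennreal r * (\<integral>\<^sup>+y. ennreal (psi r M (u - y)) * indicator {0..u} y \<partial>M)"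
proof -
  define c where "c n = ennreal ((1 - r) * r ^ Suc n)" for n
  define I where "I n = (\<integral>\<^sup>+y. emeasure (conv_power M n) {u - y<..} * indicator {0..u} y \<partial>M)" for n
  have [measurable]: "(\<lambda>v. emeasure (conv_power M n) {v<..}) \<in> borel_measurable borel" for n
    by (rule nonneg_real_distribution.measurable_emeasure_greaterThan[OF nonneg_conv_power])
  have "(\<lambda>n. r * (1 - r) * r ^ n) sums (r * (1 - r) * (1 / (1 - r)))"
    using r by (intro sums_mult geometric_sums) auto
  then have "(\<lambda>n. (1 - r) * r ^ Suc n) sums r"
    using r by (simp add: mult_ac)
  then have c: "(\<Sum>n. c n) = ennreal r"
    unfolding c_def using r by (intro suminf_ennreal_eq) auto
  have c_Suc: "c (Suc n) = ennreal r * c n" for n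
    unfolding c_def using r by (subst ennreal_mult[symmetric]) (auto simp: mult_ac)
  \<comment> \<open>The zeroth power is the point mass at zero, which has no mass beyond
    \<open>u - y\<close> when \<open>y \<le> u\<close>.\<close>
  have "I 0 = (\<integral>\<^sup>+y. 0 \<partial>M)"
    unfolding I_def by (intro nn_integral_cong) (auto split: split_indicator)
  then have I_0: "I 0 = 0" by simp
  \<comment> \<open>Dropping the zero term aligns the powers under the integral with those in
    \<open>psi\<close>, which start at one.\<close>
  have "(\<Sum>n. c n * I n) = (\<Sum>n. c (Suc n) * I (Suc n))"
    by (rule suminf_mono_reindex[symmetric])
      (use I_0 in \<open>auto simp: strict_mono_def greaterThan_0[symmetric]\<close>)
  also have "\<dots> = ennreal r * (\<Sum>n. c n * I (Suc n))"
    by (simp add: c_Suc mult.assoc)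
  also have "(\<Sum>n. c n * I (Suc n)) = (\<Sum>n. \<integral>\<^sup>+y. c n * emeasure (conv_power M (Suc n)) {u - y<..} * indicator {0..u} y \<partial>M)"
    unfolding I_def by (subst nn_integral_cmult[symmetric]) (auto simp: mult.assoc simp del: conv_power.simps)
  also have "\<dots> = (\<integral>\<^sup>+y. (\<Sum>n. c n * emeasure (conv_power M (Suc n)) {u - y<..} * indicator {0..u} y) \<partial>M)"
    by (intro nn_integral_suminf[symmetric]) (auto simp del: conv_power.simps)
  also have "\<dots> = (\<integral>\<^sup>+y. ennreal (psi r M (u - y)) * indicator {0..u} y \<partial>M)"
    unfolding ennreal_psi[OF r] c_def by simp
  finally have *: "(\<Sum>n. c n * I n) = ennreal r * (\<integral>\<^sup>+y. ennreal (psi r M (u - y)) * indicator {0..u} y \<partial>M)" .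
  have "ennreal (psi r M u) = (\<Sum>n. c n * (emeasure M {u<..} + I n))"
    unfolding ennreal_psi[OF r] conv_power_Suc_tail[OF u] c_def I_def ..
  also have "\<dots> = (\<Sum>n. c n * emeasure M {u<..}) + (\<Sum>n. c n * I n)"
    unfolding distrib_left by (rule suminf_add[symmetric]) auto
  finally show ?thesis by (simp add: * c)
qed

end

section \<open>Double series and integrals of Erlang densities\<close>

lemma suminf_ennreal_swap:
  fixes f :: "nat \<Rightarrow> nat \<Rightarrow> ennreal"
  shows "(\<Sum>i. \<Sum>j. f i j) = (\<Sum>j. \<Sum>i. f i j)"
  using nn_integral_suminf[of "\<lambda>j i. f i j" "count_space UNIV"]
  by (simp add: nn_integral_count_space_nat)

text \<open>Regrouping along \<open>N = Suc (n + m)\<close>. The offset by one is that of Erlang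
  convolution in the shape-minus-one index, and it produces the \<open>n - 1 - i\<close> in the
  recursion for \<open>kappa\<close>.\<close>

lemma suminf_ennreal_Cauchy_product_Suc:
  fixes a b g :: "nat \<Rightarrow> ennreal"
  shows "(\<Sum>n. \<Sum>m. a n * b m * g (Suc (n + m))) = (\<Sum>N. (\<Sum>m<N. a (N - 1 - m) * b m) * g N)"
proof -
  let ?f = "\<lambda>m N. if m < N then a (N - 1 - m) * b m * g N else 0"
  have "(\<Sum>n. \<Sum>m. a n * b m * g (Suc (n + m))) = (\<Sum>m. \<Sum>n. a n * b m * g (Suc (n + m)))"
    by (rule suminf_ennreal_swap)
  also have "\<dots> = (\<Sum>m. \<Sum>n. ?f m (Suc (n + m)))"
    by simp
  also have "\<dots> = (\<Sum>m. \<Sum>N. ?f m N)"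
  proof (rule arg_cong[where f = suminf], intro ext suminf_mono_reindex)
    fix m N :: nat assume N: "N \<notin> range (\<lambda>n. Suc (n + m))"
    have "\<not> m < N"
    proof
      assume "m < N"
      then have "N = Suc ((N - Suc m) + m)" by simp
      with N show False by blast
    qed
    then show "?f m N = 0" by simp
  qed (simp add: strict_mono_def)
  also have "\<dots> = (\<Sum>N. \<Sum>m. ?f m N)"
    by (rule suminf_ennreal_swap)
  also have "\<dots> = (\<Sum>N. (\<Sum>m<N. a (N - 1 - m) * b m) * g N)"
    by (intro suminf_cong, subst suminf_finite[where N = "{..<_}"]) (auto simp: sum_distrib_right)
  finally show ?thesis .
qed

text \<open>Substituting \<open>y = s * x\<close> turns rate \<open>l\<close> into
  \<open>l / s\<close>; the Jacobian \<open>1 / s\<close> cancels the factor \<open>s\<close> in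
  \<open>eq\<close>.\<close>

lemma emeasure_erlang_density_scale:
  assumes s: "0 < s" and l: "0 < l" and [measurable]: "A \<in> sets borel"
  shows "emeasure (density lborel (erlang_density k l)) {x. s * x \<in> A} =
    (\<integral>\<^sup>+y. ennreal (erlang_density k (l / s) y) * indicator A y \<partial>lborel)"
proof -
  have eq: "ennreal (erlang_density k l (y / s)) = ennreal s * ennreal (erlang_density k (l / s) y)" for y
    using s l by (subst ennreal_mult[symmetric])
      (auto simp: erlang_density_def divide_less_0_iff power_divide field_simps)
  have "emeasure (density lborel (erlang_density k l)) {x. s * x \<in> A} =
      (\<integral>\<^sup>+x. ennreal (erlang_density k l x) * indicator A (s * x) \<partial>lborel)"
    by (subst emeasure_density) (auto intro!: nn_integral_cong split: split_indicator)
  also have "\<dots> = ennreal (1 / s) * (\<integral>\<^sup>+y. ennreal (erlang_density k l (y / s)) * indicator A y \<partial>lborel)"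
    using s by (subst nn_integral_real_affine[where c = "1 / s" and t = 0]) auto
  also have "(\<integral>\<^sup>+y. ennreal (erlang_density k l (y / s)) * indicator A y \<partial>lborel) =
      ennreal s * (\<integral>\<^sup>+y. ennreal (erlang_density k (l / s) y) * indicator A y \<partial>lborel)"
    unfolding eq by (subst nn_integral_cmult[symmetric]) (auto simp: mult.assoc)
  finally show ?thesis
    using s by (simp add: mult.assoc[symmetric] ennreal_mult[symmetric])
qed

lemma nn_integral_erlang_density_greaterThan:
  assumes l: "0 < l"
  shows "(\<integral>\<^sup>+y. ennreal (erlang_density k l y) * indicator {u<..} y \<partial>lborel) = ennreal (1 - erlang_CDF k l u)"
proof -
  let ?E = "density lborel (erlang_density k l)"
  interpret prob_space ?E
    using l by (rule prob_space_erlang_density)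
  have "(\<integral>\<^sup>+y. ennreal (erlang_density k l y) * indicator {u<..} y \<partial>lborel) = emeasure ?E {u<..}"
    by (simp add: emeasure_density)
  also have "\<dots> = emeasure ?E (space ?E - {..u})"
    by (intro arg_cong2[where f = emeasure]) auto
  also have "\<dots> = ennreal (1 - prob {..u})"
    unfolding emeasure_eq_measure by (subst prob_compl) auto
  also have "prob {..u} = erlang_CDF k l u"
    using emeasure_erlang_density[OF l, of k u] l by (simp add: emeasure_eq_measure)
  finally show ?thesis .
qed

section \<open>The mixing law and the coefficients of the recursion\<close>

locale discrete_scales =
  fixes P :: "real pmf" and s :: "nat \<Rightarrow> real"
  assumes mono_s: "strict_mono_on {1..} s" and s_1_pos: "0 < s 1" and set_P: "set_pmf P = s ` {1..}"
begin

definition w :: "nat \<Rightarrow> real" where "w j = pmf P (s (Suc j))"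

text \<open>The thinning probability of component \<open>j\<close>, the ratio of its rate to the
  largest rate. Like \<open>w\<close>, it is indexed from zero to fit series over
  \<open>nat\<close>.\<close>

definition p :: "nat \<Rightarrow> real" where "p j = s 1 / s (Suc j)"

lemma s_1_le: "s 1 \<le> s (Suc j)"
  using mono_s by (cases j) (auto simp: strict_mono_on_def less_imp_le)

lemma s_pos: "0 < s (Suc j)"
  using s_1_pos s_1_le[of j] by simp

lemma p_range: "p j \<in> {0..1}"
  using s_1_pos s_pos[of j] s_1_le[of j] by (auto simp: p_def)

lemma w_nonneg [simp]: "0 \<le> w j"
  by (simp add: w_def)

text \<open>Strict monotonicity makes \<open>s\<close> a bijective enumeration of the support, so
  the integral can be reindexed as a series.\<close>

lemma nn_integral_P: "(\<integral>\<^sup>+x. f x \<partial>measure_pmf P) = (\<Sum>j. ennreal (w j) * f (s (Suc j)))"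
proof -
  have "inj_on s {1..}"
    using mono_s by (rule strict_mono_on_imp_inj_on)
  then have bij: "bij_betw (\<lambda>j. s (Suc j)) UNIV (set_pmf P)"
    by (auto simp: bij_betw_def set_P inj_on_def image_iff dest!: Suc_le_D)
  have "(\<integral>\<^sup>+x. f x \<partial>measure_pmf P) = (\<integral>\<^sup>+x. ennreal (pmf P x) * f x \<partial>count_space (set_pmf P))"
    unfolding nn_integral_measure_pmf
    by (rule nn_integral_count_space_eq) (auto simp: set_pmf_iff)
  also have "\<dots> = (\<integral>\<^sup>+j. ennreal (pmf P (s (Suc j))) * f (s (Suc j)) \<partial>count_space UNIV)"
    by (rule nn_integral_bij_count_space[OF bij, symmetric])
  finally show ?thesis
    by (simp add: nn_integral_count_space_nat w_def)
qed

lemma w_sums: "w sums 1"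
proof -
  have "(\<Sum>j. ennreal (w j)) = 1"
    using nn_integral_P[of "\<lambda>_. 1"] by simp
  then have "(\<lambda>j. ennreal (w j)) sums ennreal 1"
    by (simp add: sums_iff)
  then show ?thesis
    by (subst (asm) sums_ennreal) auto
qed

lemma summable_w:
  assumes "\<And>j. 0 \<le> f j" "\<And>j. f j \<le> 1"
  shows "summable (\<lambda>j. w j * f j)"
  by (rule summable_comparison_test'[OF sums_summable[OF w_sums], of 0])
    (use assms in \<open>auto simp: abs_mult intro!: mult_left_le\<close>)

lemma ennreal_suminf_w:
  assumes "\<And>j. 0 \<le> f j" "\<And>j. f j \<le> 1"
  shows "ennreal (\<Sum>j. w j * f j) = (\<Sum>j. ennreal (w j) * ennreal (f j))"
  using assms summable_w[OF assms]
  by (simp add: suminf_ennreal2[symmetric] ennreal_mult)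

lemma coeff_B_eq: "coeff_B P s \<xi> i = (\<Sum>j. w j * (p j * pmf (binomial_pmf i (p j)) (\<xi> - 1)))"
  by (simp add: coeff_B_def w_def p_def mult.assoc)

lemma coeff_C_eq: "coeff_C P s \<xi> n = (\<Sum>j. w j * measure (measure_pmf (binomial_pmf n (p j))) {..\<xi> - 1})"
  by (simp add: coeff_C_def w_def p_def)

lemma B_term_bounds:
  "0 \<le> p j * pmf (binomial_pmf i (p j)) k" "p j * pmf (binomial_pmf i (p j)) k \<le> 1"
  using p_range[of j] by (auto intro!: mult_le_one pmf_le_1 simp del: pmf_binomial)

lemma ennreal_coeff_B:
  "ennreal (coeff_B P s \<xi> i) = (\<Sum>j. ennreal (w j) * ennreal (p j * pmf (binomial_pmf i (p j)) (\<xi> - 1)))"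
  unfolding coeff_B_eq by (intro ennreal_suminf_w B_term_bounds)

lemma ennreal_coeff_C:
  "ennreal (coeff_C P s \<xi> n) = (\<Sum>j. ennreal (w j) * ennreal (measure (measure_pmf (binomial_pmf n (p j))) {..\<xi> - 1}))"
  unfolding coeff_C_eq by (intro ennreal_suminf_w) auto

lemma coeff_B_nonneg: "0 \<le> coeff_B P s \<xi> i"
  unfolding coeff_B_eq
  by (intro suminf_nonneg summable_w mult_nonneg_nonneg B_term_bounds) (auto simp del: pmf_binomial)

lemma coeff_C_nonneg: "0 \<le> coeff_C P s \<xi> n"
  unfolding coeff_C_eq
  by (intro suminf_nonneg summable_w mult_nonneg_nonneg) auto

lemma coeff_B_eq_0:
  assumes "i < \<xi> - 1"
  shows "coeff_B P s \<xi> i = 0"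
proof -
  have "pmf (binomial_pmf i (p j)) (\<xi> - 1) = 0" for j
    using assms p_range[of j] by simp
  then show ?thesis by (simp add: coeff_B_eq del: pmf_binomial)
qed

lemma coeff_C_eq_1:
  assumes "n \<le> \<xi> - 1"
  shows "coeff_C P s \<xi> n = 1"
  using prob_binomial_pmf_atMost_eq_1[OF p_range assms] sums_unique[OF w_sums]
  by (simp add: coeff_C_eq)

text \<open>\<open>B\<^sub>i\<close> is the probability that the \<open>\<xi>\<close>-th success occurs at trial \<open>i + 1\<close>, \<open>C\<^sub>n\<close> that it takes more than \<open>n\<close> trials.\<close>

lemma sum_coeff_B_add_coeff_C: "(\<Sum>i<n. coeff_B P s \<xi> i) + coeff_C P s \<xi> n = 1"
proof -
  have "(\<lambda>j. (\<Sum>i<n. w j * (p j * pmf (binomial_pmf i (p j)) (\<xi> - 1))) +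
        w j * measure (measure_pmf (binomial_pmf n (p j))) {..\<xi> - 1})
      sums ((\<Sum>i<n. coeff_B P s \<xi> i) + coeff_C P s \<xi> n)"
    unfolding coeff_B_eq coeff_C_eq
    by (intro sums_add sums_sum summable_sums summable_w B_term_bounds) auto
  moreover have "(\<Sum>i<n. w j * (p j * pmf (binomial_pmf i (p j)) (\<xi> - 1))) +
        w j * measure (measure_pmf (binomial_pmf n (p j))) {..\<xi> - 1} = w j" for j
    using sum_pmf_binomial_pmf_add_prob_atMost[OF p_range, where n = n and k = "\<xi> - 1" and j1 = j]
    by (simp only: sum_distrib_left[symmetric] distrib_left[symmetric] mult_1_right)
  ultimately show ?thesis
    using w_sums sums_unique2 by fastforce
qed

text \<open>Since \<open>B\<^sub>i = 0\<close> for \<open>i < \<xi> - 1\<close> and \<open>C\<^sub>n = 1\<close> for \<open>n < \<xi>\<close>, the two cases of the recursion coincide.\<close>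

lemma kappa_recursion:
  assumes "1 \<le> \<xi>"
  shows "kappa \<gamma> \<mu> P s \<xi> n =
    \<gamma> * \<mu> * ((\<Sum>i<n. kappa \<gamma> \<mu> P s \<xi> (n - 1 - i) * coeff_B P s \<xi> i) + coeff_C P s \<xi> n)"
proof (cases "n < \<xi>")
  case True
  then show ?thesis
    by (subst kappa.simps) (simp add: coeff_B_eq_0 coeff_C_eq_1)
next
  case False
  have "(\<Sum>i\<in>{\<xi> - 1..<n}. kappa \<gamma> \<mu> P s \<xi> (n - 1 - i) * coeff_B P s \<xi> i) =
      (\<Sum>i<n. kappa \<gamma> \<mu> P s \<xi> (n - 1 - i) * coeff_B P s \<xi> i)"
    by (intro sum.mono_neutral_left) (auto simp: coeff_B_eq_0)
  with False show ?thesis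
    by (subst kappa.simps) simp
qed

text \<open>By strong induction: the bracket in the recursion combines earlier values and
  \<open>1\<close> with nonnegative weights of total one, by \<open>sum_coeff_B_add_coeff_C\<close>,
  and the factor in front is below one.\<close>

lemma
  assumes \<xi>: "1 \<le> \<xi>" and r: "0 < \<gamma> * \<mu>" "\<gamma> * \<mu> < 1"
  shows kappa_nonneg: "0 \<le> kappa \<gamma> \<mu> P s \<xi> n" and kappa_le_1: "kappa \<gamma> \<mu> P s \<xi> n \<le> 1"
proof (induction n rule: less_induct)
  case (less n)
  let ?S = "\<Sum>i<n. kappa \<gamma> \<mu> P s \<xi> (n - 1 - i) * coeff_B P s \<xi> i"
  {
    case 1
    have "0 \<le> ?S"
      using less(1) by (intro sum_nonneg mult_nonneg_nonneg coeff_B_nonneg) auto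
    then show ?case
      unfolding kappa_recursion[OF \<xi>, of _ _ n]
      by (intro mult_nonneg_nonneg[OF less_imp_le[OF r(1)]] add_nonneg_nonneg coeff_C_nonneg)
  next
    case 2
    have "?S \<le> (\<Sum>i<n. coeff_B P s \<xi> i)"
      using less by (intro sum_mono mult_left_le_one_le coeff_B_nonneg) auto
    then have "?S + coeff_C P s \<xi> n \<le> 1"
      using sum_coeff_B_add_coeff_C[of \<xi> n] by simp
    then have "\<gamma> * \<mu> * (?S + coeff_C P s \<xi> n) \<le> \<gamma> * \<mu> * 1"
      using r by (intro mult_left_mono) auto
    also have "\<dots> \<le> 1" using r by simp
    finally show ?case
      by (subst kappa_recursion[OF \<xi>])
  }
qed

section \<open>Density and tail of the Erlang mixture\<close>

context
  fixes \<xi> :: nat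
  assumes \<xi>: "1 \<le> \<xi>"
begin

definition l :: real where "l = real \<xi> / s 1"

abbreviation H :: "real measure" where "H \<equiv> mellin_conv (measure_pmf P) (erlang \<xi> (real \<xi>))"

definition h :: "real \<Rightarrow> ennreal" where
  "h y = (\<Sum>n. ennreal (coeff_B P s \<xi> n) * ennreal (erlang_density n l y))"

lemma l_pos: "0 < l"
  using \<xi> s_1_pos by (simp add: l_def)

lemma p_l_pos: "0 < p j * l"
  using \<xi> s_1_pos s_pos[of j] by (simp add: p_def l_def)

lemma measurable_h [measurable]: "h \<in> borel_measurable borel"
  unfolding h_def by measurable

lemma h_neg: "y < 0 \<Longrightarrow> h y = 0"
  by (simp add: h_def erlang_density_def)

text \<open>Conditioning on the scale: given scale \<open>s (Suc j)\<close>, the product is Erlang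
  with rate \<open>\<xi> / s (Suc j)\<close>, which equals \<open>p j * l\<close>.\<close>

lemma emeasure_H:
  assumes A [measurable]: "A \<in> sets borel"
  shows "emeasure H A =
    (\<Sum>j. ennreal (w j) * (\<integral>\<^sup>+y. ennreal (erlang_density (\<xi> - 1) (p j * l) y) * indicator A y \<partial>lborel))"
proof -
  let ?G = "erlang \<xi> (real \<xi>)"
  have prob: "prob_space ?G"
    unfolding erlang_def using \<xi> by (intro prob_space_erlang_density) auto
  interpret G: prob_space ?G by fact
  have sets_G [measurable_cong]: "sets ?G = sets borel"
    by (simp add: erlang_def)
  have "(\<lambda>x. fst x * snd x) \<in> borel_measurable (measure_pmf P \<Otimes>\<^sub>M ?G)"
    by (intro borel_measurable_times measurable_compose[OF measurable_fst]
        measurable_compose[OF measurable_snd]) auto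
  then have m: "(\<lambda>(s, x). s * x) \<in> borel_measurable (measure_pmf P \<Otimes>\<^sub>M ?G)"
    by (simp add: case_prod_beta)
  let ?A = "(\<lambda>(s, x). s * x) -` A \<inter> space (measure_pmf P \<Otimes>\<^sub>M ?G)"
  have "emeasure H A = emeasure (measure_pmf P \<Otimes>\<^sub>M ?G) ?A"
    unfolding mellin_conv_def by (rule emeasure_distr[OF m A])
  also have "\<dots> = (\<integral>\<^sup>+s. emeasure ?G (Pair s -` ?A) \<partial>measure_pmf P)"
    by (intro G.emeasure_pair_measure_alt measurable_sets[OF m A])
  also have "\<dots> = (\<integral>\<^sup>+s. emeasure ?G {x. s * x \<in> A} \<partial>measure_pmf P)"
    by (intro nn_integral_cong arg_cong2[where f = emeasure])
      (auto simp: space_pair_measure erlang_def)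
  also have "\<dots> = (\<Sum>j. ennreal (w j) * emeasure ?G {x. s (Suc j) * x \<in> A})"
    by (rule nn_integral_P)
  finally have "emeasure H A = \<dots>" .
  moreover have "emeasure ?G {x. s (Suc j) * x \<in> A} =
      (\<integral>\<^sup>+y. ennreal (erlang_density (\<xi> - 1) (p j * l) y) * indicator A y \<partial>lborel)" for j
  proof -
    have "p j * l = real \<xi> / s (Suc j)"
      using s_1_pos by (simp add: p_def l_def)
    then show ?thesis
      unfolding erlang_def using s_pos \<xi> by (subst emeasure_erlang_density_scale) auto
  qed
  ultimately show ?thesis by (simp only:)
qed

text \<open>Every component of the mixture is expanded in Erlang densities of the common rate
  \<open>l\<close>. After exchanging the two sums, the sum over components is
  \<open>coeff_B\<close>.\<close>

lemma H_eq_density: "H = density lborel h"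
proof (rule measure_eqI)
  show "sets H = sets (density lborel h)"
    by (simp add: mellin_conv_def)
next
  fix A assume "A \<in> sets H"
  then have [measurable]: "A \<in> sets borel" by (simp add: mellin_conv_def)
  have erl: "ennreal (erlang_density (\<xi> - 1) (p j * l) y) =
      (\<Sum>n. ennreal (p j * pmf (binomial_pmf n (p j)) (\<xi> - 1)) * ennreal (erlang_density n l y))" for j y
  proof -
    have "ennreal (erlang_density (\<xi> - 1) (p j * l) y) =
        (\<Sum>n. ennreal (p j * pmf (binomial_pmf n (p j)) (\<xi> - 1) * erlang_density n l y))"
      using l_pos by (intro suminf_ennreal_eq[symmetric] erlang_density_sums p_range mult_nonneg_nonneg B_term_bounds
          erlang_density_nonneg) auto
    then show ?thesis
      using l_pos by (simp add: ennreal_mult[OF B_term_bounds(1)] del: pmf_binomial)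
  qed
  let ?I = "\<lambda>n. \<integral>\<^sup>+y. ennreal (erlang_density n l y) * indicator A y \<partial>lborel"
  have I: "(\<integral>\<^sup>+y. ennreal (erlang_density (\<xi> - 1) (p j * l) y) * indicator A y \<partial>lborel) =
      (\<Sum>n. ennreal (p j * pmf (binomial_pmf n (p j)) (\<xi> - 1)) * ?I n)" for j
    unfolding erl ennreal_suminf_multc[symmetric]
    by (subst nn_integral_suminf) (auto simp: nn_integral_cmult mult.assoc simp del: pmf_binomial)
  have "emeasure H A = (\<Sum>j. \<Sum>n. ennreal (w j) * (ennreal (p j * pmf (binomial_pmf n (p j)) (\<xi> - 1)) * ?I n))"
    by (simp only: emeasure_H[OF \<open>A \<in> sets borel\<close>] I ennreal_suminf_cmult)
  also have "\<dots> = (\<Sum>n. \<Sum>j. ennreal (w j) * (ennreal (p j * pmf (binomial_pmf n (p j)) (\<xi> - 1)) * ?I n))"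
    by (rule suminf_ennreal_swap)
  also have "\<dots> = (\<Sum>n. ennreal (coeff_B P s \<xi> n) * ?I n)"
    by (simp only: ennreal_coeff_B mult.assoc[symmetric] ennreal_suminf_multc)
  also have "\<dots> = (\<integral>\<^sup>+y. h y * indicator A y \<partial>lborel)"
    unfolding h_def ennreal_suminf_multc[symmetric]
    by (subst nn_integral_suminf) (auto simp: nn_integral_cmult mult.assoc)
  also have "\<dots> = emeasure (density lborel h) A"
    by (simp add: emeasure_density)
  finally show "emeasure H A = emeasure (density lborel h) A" .
qed

lemma nonneg_H: "nonneg_real_distribution H"
proof -
  \<comment> \<open>The total mass of a component is its zeroth moment.\<close>
  have "(\<integral>\<^sup>+y. ennreal (erlang_density (\<xi> - 1) (p j * l) y) * indicator UNIV y \<partial>lborel) = 1" for j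
    using nn_integral_erlang_ith_moment[of "p j * l" "\<xi> - 1" 0] p_l_pos[of j] by simp
  then have "emeasure H UNIV = (\<Sum>j. ennreal (w j))"
    by (simp add: emeasure_H)
  also have "\<dots> = ennreal 1"
    by (intro suminf_ennreal_eq w_sums w_nonneg)
  finally have "prob_space H"
    by (intro prob_spaceI) (simp add: mellin_conv_def)
  moreover have "AE y in H. 0 \<le> y"
    unfolding H_eq_density by (subst AE_density) (auto intro!: AE_I2, metis h_neg less_irrefl not_le)
  moreover have "sets H = sets borel"
    by (simp add: mellin_conv_def)
  ultimately show ?thesis
    by (simp add: nonneg_real_distribution_def nonneg_real_distribution_axioms_def
        real_distribution_def real_distribution_axioms_def)
qed

text \<open>The Poisson weight of \<open>n\<close> at \<open>l * u\<close>, written through the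
  Erlang density so that it vanishes for negative \<open>u\<close> and inherits the convolution
  formula.\<close>

definition q :: "nat \<Rightarrow> real \<Rightarrow> ennreal" where "q n u = ennreal (erlang_density n l u / l)"

lemma q_eq: "0 \<le> u \<Longrightarrow> q n u = ennreal ((l * u) ^ n * exp (- (l * u)) / fact n)"
  using l_pos unfolding q_def by (simp add: erlang_density_def power_mult_distrib)

lemma q_neg: "u < 0 \<Longrightarrow> q n u = 0"
  by (simp add: q_def erlang_density_def)

lemma measurable_q [measurable]: "q n \<in> borel_measurable borel"
  unfolding q_def by measurable

lemma q_convolution: "(\<integral>\<^sup>+y. q n (u - y) * ennreal (erlang_density m l y) \<partial>lborel) = q (Suc (n + m)) u"
proof -
  have q: "q n v = ennreal (1 / l) * ennreal (erlang_density n l v)" for n v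
    using l_pos unfolding q_def by (subst ennreal_mult[symmetric]) auto
  have "(\<integral>\<^sup>+y. q n (u - y) * ennreal (erlang_density m l y) \<partial>lborel) =
      ennreal (1 / l) * (\<integral>\<^sup>+y. ennreal (erlang_density n l (u - y)) * ennreal (erlang_density m l y) \<partial>lborel)"
    unfolding q mult.assoc by (intro nn_integral_cmult) measurable
  also have "\<dots> = ennreal (1 / l) * ennreal (erlang_density (Suc (n + m)) l u)"
    using fun_cong[OF convolution_erlang_density[OF l_pos, of n m], of u] by simp
  finally show ?thesis
    unfolding q .
qed

text \<open>The same expansion and exchange of sums as for the density, now with
  \<open>erlang_tail_sums\<close> and \<open>coeff_C\<close>.\<close>

lemma H_tail:
  assumes u: "0 \<le> u"
  shows "emeasure H {u<..} = (\<Sum>n. ennreal (coeff_C P s \<xi> n) * q n u)"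
proof -
  have tail: "(\<integral>\<^sup>+y. ennreal (erlang_density (\<xi> - 1) (p j * l) y) * indicator {u<..} y \<partial>lborel) =
      (\<Sum>n. ennreal (measure (measure_pmf (binomial_pmf n (p j))) {..\<xi> - 1}) * q n u)" for j
  proof -
    have "(\<integral>\<^sup>+y. ennreal (erlang_density (\<xi> - 1) (p j * l) y) * indicator {u<..} y \<partial>lborel) =
        ennreal (1 - erlang_CDF (\<xi> - 1) (p j * l) u)"
      by (rule nn_integral_erlang_density_greaterThan[OF p_l_pos])
    also have "\<dots> = (\<Sum>n. ennreal (measure (measure_pmf (binomial_pmf n (p j))) {..\<xi> - 1} * ((l * u) ^ n * exp (- (l * u)) / fact n)))"
      using u l_pos by (intro suminf_ennreal_eq[symmetric] erlang_tail_sums p_range) auto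
    also have "\<dots> = (\<Sum>n. ennreal (measure (measure_pmf (binomial_pmf n (p j))) {..\<xi> - 1}) * q n u)"
      unfolding q_eq[OF u] using u l_pos by (subst ennreal_mult) auto
    finally show ?thesis .
  qed
  have "emeasure H {u<..} =
      (\<Sum>j. \<Sum>n. ennreal (w j) * (ennreal (measure (measure_pmf (binomial_pmf n (p j))) {..\<xi> - 1}) * q n u))"
    by (simp only: emeasure_H[OF greaterThan_borel] tail ennreal_suminf_cmult)
  also have "\<dots> = (\<Sum>n. \<Sum>j. ennreal (w j) * (ennreal (measure (measure_pmf (binomial_pmf n (p j))) {..\<xi> - 1}) * q n u))"
    by (rule suminf_ennreal_swap)
  also have "\<dots> = (\<Sum>n. ennreal (coeff_C P s \<xi> n) * q n u)"
    by (simp only: ennreal_coeff_C mult.assoc[symmetric] ennreal_suminf_multc)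
  finally show ?thesis .
qed

section \<open>The renewal equation for the claimed series\<close>

context
  fixes \<gamma> \<mu> :: real
  assumes r: "0 < \<gamma> * \<mu>" "\<gamma> * \<mu> < 1"
begin

definition \<phi> :: "real \<Rightarrow> ennreal" where
  "\<phi> u = (\<Sum>n. ennreal (kappa \<gamma> \<mu> P s \<xi> n) * q n u)"

lemma measurable_\<phi> [measurable]: "\<phi> \<in> borel_measurable borel"
  unfolding \<phi>_def by measurable

text \<open>The coefficients are at most one and the Poisson weights sum to one.\<close>

lemma \<phi>_le_1:
  assumes u: "0 \<le> u"
  shows "\<phi> u \<le> 1"
proof -
  have "(\<lambda>n. exp (- (l * u)) * ((l * u) ^ n /\<^sub>R fact n)) sums (exp (- (l * u)) * exp (l * u))"
    by (intro sums_mult exp_converges)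
  then have "(\<lambda>n. (l * u) ^ n * exp (- (l * u)) / fact n) sums 1"
    by (simp add: exp_minus field_simps)
  then have "(\<Sum>n. q n u) = ennreal 1"
    unfolding q_eq[OF u] using u l_pos by (intro suminf_ennreal_eq) auto
  moreover have "\<phi> u \<le> (\<Sum>n. q n u)"
    unfolding \<phi>_def
    using mult_right_mono[of "ennreal (kappa \<gamma> \<mu> P s \<xi> _)" 1] kappa_le_1[OF \<xi> r]
    by (intro suminf_le summableI) auto
  ultimately show ?thesis by simp
qed

text \<open>Integrating \<open>\<phi>\<close> against the density \<open>h\<close> gives a double
  series of convolutions, each again a Poisson weight by \<open>q_convolution\<close>. Collecting
  equal indices gives the sum in the recursion, and \<open>H_tail\<close> supplies the
  \<open>coeff_C\<close> part.\<close>

lemma \<phi>_renewal: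
  assumes u: "0 \<le> u"
  shows "\<phi> u = ennreal (\<gamma> * \<mu>) * emeasure H {u<..} +
    ennreal (\<gamma> * \<mu>) * (\<integral>\<^sup>+y. \<phi> (u - y) * indicator {0..u} y \<partial>H)"
proof -
  let ?k = "\<lambda>n. ennreal (kappa \<gamma> \<mu> P s \<xi> n)" and ?B = "\<lambda>n. ennreal (coeff_B P s \<xi> n)"
  let ?C = "\<lambda>n. ennreal (coeff_C P s \<xi> n)"
  have "(\<integral>\<^sup>+y. \<phi> (u - y) * indicator {0..u} y \<partial>H) = (\<integral>\<^sup>+y. h y * (\<phi> (u - y) * indicator {0..u} y) \<partial>lborel)"
    unfolding H_eq_density by (intro nn_integral_density) auto
  also have "\<dots> = (\<integral>\<^sup>+y. (\<Sum>n. \<Sum>m. ?k n * ?B m * (q n (u - y) * ennreal (erlang_density m l y))) \<partial>lborel)"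
  proof (intro nn_integral_cong)
    fix y
    \<comment> \<open>The indicator is redundant: \<open>h\<close> vanishes for \<open>y < 0\<close>
      and \<open>\<phi> (u - y)\<close> for \<open>y > u\<close>.\<close>
    have "h y * (\<phi> (u - y) * indicator {0..u} y) = \<phi> (u - y) * h y"
      by (auto simp: h_neg \<phi>_def q_neg mult.commute split: split_indicator)
    also have "\<dots> = (\<Sum>n. \<Sum>m. (?k n * q n (u - y)) * (?B m * ennreal (erlang_density m l y)))"
      unfolding \<phi>_def h_def by (simp only: ennreal_suminf_multc ennreal_suminf_cmult)
    finally show "h y * (\<phi> (u - y) * indicator {0..u} y) =
        (\<Sum>n. \<Sum>m. ?k n * ?B m * (q n (u - y) * ennreal (erlang_density m l y)))"
      by (simp only: mult_ac)
  qed
  also have "\<dots> = (\<Sum>n. \<Sum>m. ?k n * ?B m * q (Suc (n + m)) u)"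
    by (simp add: nn_integral_suminf nn_integral_cmult q_convolution del: ennreal_suminf_cmult ennreal_suminf_multc)
  also have "\<dots> = (\<Sum>N. (\<Sum>m<N. ?k (N - 1 - m) * ?B m) * q N u)"
    by (rule suminf_ennreal_Cauchy_product_Suc)
  finally have conv: "(\<integral>\<^sup>+y. \<phi> (u - y) * indicator {0..u} y \<partial>H) = \<dots>" .
  \<comment> \<open>The recursion carried over to \<open>ennreal\<close>, which is compatible with
    sums and products because all quantities are nonnegative.\<close>
  have *: "?k N = ennreal (\<gamma> * \<mu>) * (?C N + (\<Sum>m<N. ?k (N - 1 - m) * ?B m))" for N
  proof -
    have "0 \<le> (\<Sum>m<N. kappa \<gamma> \<mu> P s \<xi> (N - 1 - m) * coeff_B P s \<xi> m)"
      by (intro sum_nonneg mult_nonneg_nonneg kappa_nonneg[OF \<xi> r] coeff_B_nonneg)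
    then have "?k N = ennreal (\<gamma> * \<mu>) * (?C N + ennreal (\<Sum>m<N. kappa \<gamma> \<mu> P s \<xi> (N - 1 - m) * coeff_B P s \<xi> m))"
      by (subst kappa_recursion[OF \<xi>])
        (use r coeff_C_nonneg in \<open>simp add: ennreal_mult ennreal_plus[symmetric] add.commute del: ennreal_plus\<close>)
    then show ?thesis
      by (simp add: ennreal_mult kappa_nonneg[OF \<xi> r] coeff_B_nonneg flip: sum_ennreal)
  qed
  have "\<phi> u = (\<Sum>N. ennreal (\<gamma> * \<mu>) * (?C N * q N u) + ennreal (\<gamma> * \<mu>) * ((\<Sum>m<N. ?k (N - 1 - m) * ?B m) * q N u))"
    unfolding \<phi>_def
    by (intro suminf_cong, subst *) (simp only: distrib_left distrib_right mult.assoc)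
  also have "\<dots> = ennreal (\<gamma> * \<mu>) * (\<Sum>N. ?C N * q N u) + ennreal (\<gamma> * \<mu>) * (\<Sum>N. (\<Sum>m<N. ?k (N - 1 - m) * ?B m) * q N u)"
    by (subst suminf_add[symmetric]) auto
  finally show ?thesis
    unfolding conv H_tail[OF u] .
qed

text \<open>Both functions are bounded by one and solve the same renewal equation, so
  \<open>renewal_equation_le\<close> applies in each direction.\<close>

lemma \<phi>_eq_psi:
  assumes u: "0 \<le> u"
  shows "\<phi> u = ennreal (psi (\<gamma> * \<mu>) H u)"
proof -
  interpret H: nonneg_real_distribution H by (rule nonneg_H)
  have [measurable]: "(\<lambda>u. ennreal (psi (\<gamma> * \<mu>) H u)) \<in> borel_measurable borel"
    using r by (rule H.measurable_ennreal_psi)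
  have lt: "ennreal (\<gamma> * \<mu>) < 1"
    using r by (simp add: ennreal_less_one_iff)
  show ?thesis
  proof (rule antisym)
    show "\<phi> u \<le> ennreal (psi (\<gamma> * \<mu>) H u)"
      by (rule renewal_equation_le[OF H.prob_space_axioms H.events_eq_borel _ \<phi>_renewal H.psi_renewal[OF r] \<phi>_le_1 lt u])
        auto
    show "ennreal (psi (\<gamma> * \<mu>) H u) \<le> \<phi> u"
      by (rule renewal_equation_le[OF H.prob_space_axioms H.events_eq_borel _ H.psi_renewal[OF r] \<phi>_renewal _ lt u])
        (use H.psi_le_1[OF r] in auto)
  qed
qed

end

end

end

section \<open>Return from extended nonnegative to real series\<close>

theorem theorem3p4:
  fixes P :: "real pmf" and s :: "nat \<Rightarrow> real" and \<xi> :: nat and \<gamma> \<mu>\<^sub>F \<rho> u :: real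
  assumes "strict_mono_on {1..} s"
    and "0 < s 1"
    and "set_pmf P = s ` {1..}"
    and "1 \<le> \<xi>"
    and "0 < \<gamma>"
    and "0 < \<mu>\<^sub>F"
    and "\<rho> = \<gamma> * \<mu>\<^sub>F"
    and "\<rho> < 1"
    and "0 \<le> u"
  shows "(\<lambda>n. kappa \<gamma> \<mu>\<^sub>F P s \<xi> n * ((real \<xi> * u / s 1) ^ n * exp (- (real \<xi> * u / s 1)) / fact n))
           sums psi \<rho> (mellin_conv (measure_pmf P) (erlang \<xi> (real \<xi>))) u"
proof -
  interpret discrete_scales P s
    using assms by unfold_locales
  have r: "0 < \<gamma> * \<mu>\<^sub>F" "\<gamma> * \<mu>\<^sub>F < 1"
    using assms by auto
  interpret H: nonneg_real_distribution "H \<xi>"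
    by (rule nonneg_H) fact
  let ?f = "\<lambda>n. kappa \<gamma> \<mu>\<^sub>F P s \<xi> n * ((real \<xi> * u / s 1) ^ n * exp (- (real \<xi> * u / s 1)) / fact n)"
  have nonneg: "0 \<le> ?f n" for n
    using \<open>0 \<le> u\<close> s_1_pos kappa_nonneg[OF \<open>1 \<le> \<xi>\<close> r] by simp
  have "(\<lambda>n. ennreal (?f n)) = (\<lambda>n. ennreal (kappa \<gamma> \<mu>\<^sub>F P s \<xi> n) * q \<xi> n u)"
    using \<open>0 \<le> u\<close> s_1_pos kappa_nonneg[OF \<open>1 \<le> \<xi>\<close> r]
    by (simp add: q_eq[OF \<open>1 \<le> \<xi>\<close>] l_def[OF \<open>1 \<le> \<xi>\<close>] ennreal_mult[symmetric] del: times_divide_eq_right)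
  then have "(\<Sum>n. ennreal (?f n)) = ennreal (psi (\<gamma> * \<mu>\<^sub>F) (H \<xi>) u)"
    using \<phi>_eq_psi[OF \<open>1 \<le> \<xi>\<close> r \<open>0 \<le> u\<close>] by (simp add: \<phi>_def[OF \<open>1 \<le> \<xi>\<close> r])
  \<comment> \<open>Since the terms and the limit are nonnegative reals, convergence in
    \<open>ennreal\<close> to this finite value is convergence in the reals.\<close>
  then have "(\<lambda>n. ennreal (?f n)) sums ennreal (psi (\<gamma> * \<mu>\<^sub>F) (H \<xi>) u)"
    by (simp add: sums_iff)
  then show ?thesis
    using nonneg H.psi_nonneg[OF r] \<open>\<rho> = \<gamma> * \<mu>\<^sub>F\<close> by (subst (asm) sums_ennreal) auto
qed

end
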